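(* Let $W=\mathbb R^2$ be the standard reflection representation of the dihedral group $I_2(m)$ (of order $2m$). Then $\mathcal P_4(I_2(m),W)=0$ for $m=3$ and for every $m\ge5$. For $m=4$ there are primitive quartic invariants, i.e. $\mathcal P_4(I_2(4),W)\neq0$.
   Context: For these groups ($m\ge3$), $W$ is irreducible with $\operatorname{End}_{G}(W)=\mathbb R$, $G=I_2(m)$. Put $V=W\oplus W$ with diagonal $G$-action. For $x=(x_1,x_2)\in V$ let $H(x)=((x_i,x_j))_{i,j}$ be the real symmetric $2\times2$ Gram matrix of $x_1,x_2$ and, for a real symmetric $2\times2$ matrix $B$, let $\gamma_B(x)=\operatorname{tr}(BH(x))$. Let $\mathcal G_4(G,W)$ be the span of all products $\gamma_B\gamma_C$ inside the space $\operatorname{Sym}^4(V^* )^G$ of real $G$-invariant homogeneous quartic polynomials on $V$, and $\mathcal P_4(G,W)=\operatorname{Sym}^4(V^* )^G/\mathcal G_4(G,W)$ (the primitive quartic obstruction space). *)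

theory Defs
  imports "HOL-Analysis.Analysis" "HOL-Library.Function_Algebras" "HOL-Library.Set_Algebras"
begin

section \<open>Real-valued functions as a real vector space\<close>

instantiation "fun" :: (type, real_vector) real_vector
begin

definition scaleR_fun_def: "r *\<^sub>R f = (\<lambda>x. r *\<^sub>R f x)"

instance
  by standard (auto simp: scaleR_fun_def fun_eq_iff algebra_simps)

end

lemma scaleR_fun_apply [simp]: "(r *\<^sub>R f) x = r *\<^sub>R f x"
  by (simp add: scaleR_fun_def)

section \<open>Homogeneous polynomials\<close>

text \<open>The symmetric power \<open>Sym\<^sup>d(V\<^sup>*)\<close>, realised as polynomial functions on \<open>V\<close>: the span of the
  products of \<open>d\<close> linear forms.  It consists of the polynomial functions that are homogeneous
  of degree \<open>d\<close>, see \<open>sym_power_iff\<close> below.\<close>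

definition sym_power :: "nat \<Rightarrow> ('v::euclidean_space \<Rightarrow> real) set" where
  "sym_power d = span {\<lambda>x. \<Prod>i<d. l i x | l. \<forall>i<d. linear (l i)}"

lemma sym_power_zero: "(\<lambda>x. 0) \<in> sym_power d"
  using span_zero[where 'a = "'a \<Rightarrow> real"] unfolding sym_power_def zero_fun_def .

lemma sym_power_linear: "linear f \<Longrightarrow> f \<in> sym_power 1"
  unfolding sym_power_def
  by (rule span_base) (auto intro!: exI[of _ "\<lambda>_. f"])

lemma sym_power_const: "(\<lambda>x. c) \<in> sym_power 0"
proof -
  have "c *\<^sub>R (\<lambda>x. 1) \<in> sym_power 0"
    unfolding sym_power_def by (intro span_scale span_base) auto
  then show ?thesis
    by (simp add: scaleR_fun_def)
qed

lemma prod_append_lessThan: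
  fixes l k :: "nat \<Rightarrow> real"
  shows "(\<Prod>i<d. l i) * (\<Prod>i<e. k i) = (\<Prod>i<d + e. if i < d then l i else k (i - d))"
  by (induction e) (simp_all add: mult.assoc[symmetric])

lemma sym_power_mult:
  assumes "f \<in> sym_power d" "g \<in> sym_power e"
  shows "(\<lambda>x. f x * g x) \<in> sym_power (d + e)"
proof -
  have mult_gen: "(\<lambda>x. (\<Prod>i<d. l i x) * g x) \<in> sym_power (d + e)"
    if l: "\<forall>i<d. linear (l i)" for l
    using assms(2) unfolding sym_power_def[of e]
  proof (induction rule: span_induct_alt)
    case base
    then show ?case
      by (simp add: sym_power_zero zero_fun_def)
  next
    case (step c u h)
    then obtain k where k: "u = (\<lambda>x. \<Prod>i<e. k i x)" "\<forall>i<e. linear (k i)"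
      by auto
    have "(\<lambda>x. (\<Prod>i<d. l i x) * u x)
        = (\<lambda>x. \<Prod>i<d + e. (\<lambda>i. if i < d then l i else k (i - d)) i x)"
      unfolding k(1) prod_append_lessThan by (intro ext prod.cong) simp_all
    moreover have "\<forall>i<d + e. linear ((\<lambda>i. if i < d then l i else k (i - d)) i)"
    proof (intro allI impI)
      fix i assume "i < d + e"
      then show "linear (if i < d then l i else k (i - d))"
        using l[rule_format, of i] k(2)[rule_format, of "i - d"] by (cases "i < d") simp_all
    qed
    ultimately have "(\<lambda>x. (\<Prod>i<d. l i x) * u x) \<in> sym_power (d + e)"
      unfolding sym_power_def by (intro span_base CollectI exI conjI)
    then have "c *\<^sub>R (\<lambda>x. (\<Prod>i<d. l i x) * u x) + (\<lambda>x. (\<Prod>i<d. l i x) * h x) \<in> sym_power (d + e)"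
      using step.IH unfolding sym_power_def by (intro span_add span_scale) auto
    then show ?case
      by (simp add: plus_fun_def scaleR_fun_def algebra_simps)
  qed
  show ?thesis
    using assms(1) unfolding sym_power_def[of d]
  proof (induction rule: span_induct_alt)
    case base
    then show ?case
      by (simp add: sym_power_zero zero_fun_def)
  next
    case (step c u h)
    then have "c *\<^sub>R (\<lambda>x. u x * g x) + (\<lambda>x. h x * g x) \<in> sym_power (d + e)"
      using mult_gen unfolding sym_power_def by (intro span_add span_scale) auto
    then show ?case
      by (simp add: plus_fun_def scaleR_fun_def algebra_simps)
  qed
qed

lemma sym_power_homogeneous:
  assumes "f \<in> sym_power d"
  shows "f (c *\<^sub>R x) = c ^ d * f x"
  using assms unfolding sym_power_def
proof (induction rule: span_induct_alt)
  case (step a u h)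
  then obtain l where "u = (\<lambda>x. \<Prod>i<d. l i x)" "\<forall>i<d. linear (l i)"
    by auto
  then have "u (c *\<^sub>R x) = c ^ d * u x"
    by (simp add: linear_scale prod.distrib)
  then show ?case
    using step.IH by (simp add: algebra_simps)
qed simp

lemma sym_power_polynomial:
  assumes "f \<in> sym_power d"
  shows "real_polynomial_function f"
  using assms unfolding sym_power_def
proof (induction rule: span_induct_alt)
  case base
  then show ?case
    using real_polynomial_function.intros(2)[of 0] by (simp add: zero_fun_def)
next
  case (step a u h)
  then obtain l where "u = (\<lambda>x. \<Prod>i<d. l i x)" "\<forall>i<d. linear (l i)"
    by auto
  then have "real_polynomial_function u"
    by (simp only:) (intro real_polynomial_function_prod real_polynomial_function.intros(1);
        simp add: linear_conv_bounded_linear)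
  then show ?case
    using step.IH
    by (simp add: plus_fun_def scaleR_fun_def real_polynomial_function.intros(3)
        real_polynomial_function.intros(4) real_polynomial_function.intros(2))
qed

lemma sym_power_sum:
  "(\<And>i. i \<in> I \<Longrightarrow> h i \<in> sym_power d) \<Longrightarrow> (\<lambda>x. \<Sum>i\<in>I. h i x) \<in> sym_power d"
proof (induction I rule: infinite_finite_induct)
  case (insert i I)
  then have "h i + (\<lambda>x. \<Sum>i\<in>I. h i x) \<in> sym_power d"
    unfolding sym_power_def by (intro span_add) auto
  then show ?case
    using insert by (simp add: plus_fun_def)
qed (auto simp: sym_power_zero)

lemma polynomial_decompose:
  fixes f :: "'v::euclidean_space \<Rightarrow> real"
  assumes "real_polynomial_function f"
  shows "\<exists>N h. (\<forall>k. h k \<in> sym_power k) \<and> (\<forall>k>N. h k = (\<lambda>x. 0)) \<and> f = (\<lambda>x. \<Sum>k\<le>N. h k x)"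
  using assms
proof induction
  case (linear f)
  then have "f \<in> sym_power 1"
    by (intro sym_power_linear) (simp add: linear_conv_bounded_linear)
  then show ?case
    by (intro exI[of _ 1] exI[of _ "\<lambda>k. if k = 1 then f else (\<lambda>x. 0)"]) (auto simp: sym_power_zero)
next
  case (const c)
  then show ?case
    by (intro exI[of _ 0] exI[of _ "\<lambda>k. if k = 0 then (\<lambda>x. c) else (\<lambda>x. 0)"])
      (auto simp: sym_power_zero sym_power_const)
next
  case (add f g)
  then obtain N h M k where
    "(\<forall>i. h i \<in> sym_power i) \<and> (\<forall>i>N. h i = (\<lambda>x. 0)) \<and> f = (\<lambda>x. \<Sum>i\<le>N. h i x)"
    "(\<forall>i. k i \<in> sym_power i) \<and> (\<forall>i>M. k i = (\<lambda>x. 0)) \<and> g = (\<lambda>x. \<Sum>i\<le>M. k i x)"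
    by (elim exE)
  then have
    h: "\<And>i. h i \<in> sym_power i" "\<And>i. i > N \<Longrightarrow> h i = (\<lambda>x. 0)" "f = (\<lambda>x. \<Sum>i\<le>N. h i x)" and
    k: "\<And>i. k i \<in> sym_power i" "\<And>i. i > M \<Longrightarrow> k i = (\<lambda>x. 0)" "g = (\<lambda>x. \<Sum>i\<le>M. k i x)"
    by simp_all
  have "f = (\<lambda>x. \<Sum>i\<le>N + M. h i x)" "g = (\<lambda>x. \<Sum>i\<le>N + M. k i x)"
    unfolding h(3) k(3) by (intro ext sum.mono_neutral_left; simp add: h(2) k(2) not_le)+
  then have "(\<lambda>x. f x + g x) = (\<lambda>x. \<Sum>i\<le>N + M. (h i + k i) x)"
    by (simp add: sum.distrib)
  moreover have "h i + k i \<in> sym_power i" for i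
    using h(1) k(1) unfolding sym_power_def by (intro span_add) auto
  moreover have "h i + k i = (\<lambda>x. 0)" if "i > N + M" for i
    using that by (simp add: h(2) k(2) plus_fun_def)
  ultimately show ?case
    by (intro exI[of _ "N + M"] exI[of _ "\<lambda>i. h i + k i"]) blast
next
  case (mult f g)
  then obtain N h M k where
    "(\<forall>i. h i \<in> sym_power i) \<and> (\<forall>i>N. h i = (\<lambda>x. 0)) \<and> f = (\<lambda>x. \<Sum>i\<le>N. h i x)"
    "(\<forall>i. k i \<in> sym_power i) \<and> (\<forall>i>M. k i = (\<lambda>x. 0)) \<and> g = (\<lambda>x. \<Sum>i\<le>M. k i x)"
    by (elim exE)
  then have
    h: "\<And>i. h i \<in> sym_power i" "\<And>i. i > N \<Longrightarrow> h i = (\<lambda>x. 0)" "f = (\<lambda>x. \<Sum>i\<le>N. h i x)" and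
    k: "\<And>i. k i \<in> sym_power i" "\<And>i. i > M \<Longrightarrow> k i = (\<lambda>x. 0)" "g = (\<lambda>x. \<Sum>i\<le>M. k i x)"
    by simp_all
  define p where "p = (\<lambda>n x. \<Sum>i\<le>n. h i x * k (n - i) x)"
  have "f x * g x = (\<Sum>n\<le>N + M. p n x)" for x
  proof -
    have "f x * g x = (\<Sum>n\<le>N + M. h n x * 1 ^ n) * (\<Sum>n\<le>N + M. k n x * 1 ^ n)"
    proof -
      have "(\<Sum>i\<le>N. h i x) = (\<Sum>n\<le>N + M. h n x)" "(\<Sum>i\<le>M. k i x) = (\<Sum>n\<le>N + M. k n x)"
        by (intro sum.mono_neutral_left; simp add: h(2) k(2) not_le)+
      then show ?thesis by (simp add: h(3) k(3))
    qed
    then have "f x * g x = (\<Sum>i\<le>N. h i x * 1 ^ i) * (\<Sum>i\<le>M. k i x * 1 ^ i)"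
      by (simp add: h(3) k(3))
    also have "\<dots> = (\<Sum>r\<le>N + M. (\<Sum>i\<le>r. h i x * k (r - i) x) * 1 ^ r)"
      by (rule polynomial_product) (auto simp: h(2) k(2))
    finally show ?thesis by (simp add: p_def)
  qed
  moreover have "p n \<in> sym_power n" for n
    unfolding p_def
  proof (rule sym_power_sum)
    fix i assume "i \<in> {..n}"
    then show "(\<lambda>x. h i x * k (n - i) x) \<in> sym_power n"
      using sym_power_mult[OF h(1)[of i] k(1)[of "n - i"]] by simp
  qed
  moreover have "p n = (\<lambda>x. 0)" if "n > N + M" for n
  proof -
    have "h i x * k (n - i) x = 0" for i x
      using that h(2)[of i] k(2)[of "n - i"] by (cases "i > N") auto
    then show ?thesis
      unfolding p_def by (intro ext sum.neutral) blast
  qed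
  ultimately show ?case
    by (intro exI[of _ "N + M"] exI[of _ p]) auto
qed

theorem sym_power_iff:
  "f \<in> sym_power d \<longleftrightarrow> real_polynomial_function f \<and> (\<forall>c x. f (c *\<^sub>R x) = c ^ d * f x)"
proof (intro iffI conjI allI; (elim conjE)?)
  assume poly: "real_polynomial_function f" and hom: "\<forall>c x. f (c *\<^sub>R x) = c ^ d * f x"
  from polynomial_decompose[OF poly] obtain N h where
    "(\<forall>i. h i \<in> sym_power i) \<and> (\<forall>i>N. h i = (\<lambda>x. 0)) \<and> f = (\<lambda>x. \<Sum>i\<le>N. h i x)"
    by (elim exE)
  then have
    h: "\<And>i. h i \<in> sym_power i" "\<And>i. i > N \<Longrightarrow> h i = (\<lambda>x. 0)" "f = (\<lambda>x. \<Sum>i\<le>N. h i x)"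
    by simp_all
  have "f x = h d x" for x
  proof -
    have "(\<Sum>i\<le>N + d. h i x * c ^ i) = (\<Sum>i\<le>N + d. (if i = d then f x else 0) * c ^ i)" for c
    proof -
      have "(\<Sum>i\<le>N + d. h i x * c ^ i) = (\<Sum>i\<le>N. h i x * c ^ i)"
        by (rule sum.mono_neutral_right) (auto simp: h(2))
      also have "\<dots> = f (c *\<^sub>R x)"
        unfolding h(3) by (intro sum.cong) (auto simp: sym_power_homogeneous[OF h(1)])
      also have "\<dots> = (\<Sum>i\<le>N + d. (if i = d then f x else 0) * c ^ i)"
        using hom by (simp add: if_distrib[of "\<lambda>a. a * _"] sum.delta cong: if_cong)
      finally show ?thesis .
    qed
    then have "\<forall>i\<le>N + d. h i x = (if i = d then f x else 0)"
      unfolding polyfun_eq_coeffs[symmetric] by blast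
    then show ?thesis by simp
  qed
  then have "f = h d" by blast
  then show "f \<in> sym_power d" using h(1) by simp
qed (auto simp: sym_power_homogeneous sym_power_polynomial)

section \<open>Gram quartics and primitive quartics\<close>

text \<open>Throughout, \<open>W = real^'n\<close> with its standard inner product, a linear group acting on \<open>W\<close>
  is given as a set \<open>G\<close> of matrices, and \<open>V = W \<oplus> W\<close> is the product type.\<close>

definition diag_act :: "real^'n^'n \<Rightarrow> (real^'n) \<times> (real^'n) \<Rightarrow> (real^'n) \<times> (real^'n)" where
  "diag_act g = (\<lambda>(x1, x2). (g *v x1, g *v x2))"

definition invariant_quartics :: "(real^'n^'n) set \<Rightarrow> ((real^'n) \<times> (real^'n) \<Rightarrow> real) set" where
  "invariant_quartics G = {f \<in> sym_power 4. \<forall>g\<in>G. \<forall>x. f (diag_act g x) = f x}"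

definition gram :: "(real^'n) \<times> (real^'n) \<Rightarrow> real^2^2" where
  "gram = (\<lambda>(x1, x2). vector [vector [x1 \<bullet> x1, x1 \<bullet> x2],
                              vector [x2 \<bullet> x1, x2 \<bullet> x2]])"

definition gram_form :: "real^2^2 \<Rightarrow> (real^'n) \<times> (real^'n) \<Rightarrow> real" where
  "gram_form B x = trace (B ** gram x)"

text \<open>The group does not enter the definition; for a group of orthogonal matrices the span
  lies in the invariant quartics, see \<open>gram_quartics_subset\<close>.\<close>

definition gram_quartics :: "((real^'n) \<times> (real^'n) \<Rightarrow> real) set" where
  "gram_quartics =
     span {\<lambda>x. gram_form B x * gram_form C x | B C. transpose B = B \<and> transpose C = C}"

text \<open>The quotient space, as the set of cosets; its zero element is the coset
  \<open>0 +o gram_quartics\<close>.\<close>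

definition primitive_quartics :: "(real^'n^'n) set \<Rightarrow> ((real^'n) \<times> (real^'n) \<Rightarrow> real) set set" where
  "primitive_quartics G = (\<lambda>f. f +o gram_quartics) ` invariant_quartics G"

lemma gram_form_expand:
  "gram_form B (x, y) = B$1$1 * (x \<bullet> x) + B$1$2 * (y \<bullet> x) + B$2$1 * (x \<bullet> y) + B$2$2 * (y \<bullet> y)"
  by (simp add: gram_form_def gram_def trace_def matrix_matrix_mult_def sum_2 vector_2)

lemma gram_form_diag_act:
  assumes "orthogonal_matrix g"
  shows "gram_form B (diag_act g x) = gram_form B x"
proof -
  have "(g *v u) \<bullet> (g *v v) = u \<bullet> v" for u v
    using assms by (metis orthogonal_transformation_matrix orthogonal_transformation_def
        matrix_of_matrix_vector_mul matrix_vector_mul_linear)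
  then show ?thesis
    by (cases x) (simp add: diag_act_def gram_form_expand)
qed

lemma gram_form_sym_power:
  "(gram_form B :: (real^'n) \<times> (real^'n) \<Rightarrow> real) \<in> sym_power 2"
proof -
  have coord: "real_polynomial_function (\<lambda>z :: (real^'n) \<times> (real^'n). fst z $ i)"
    "real_polynomial_function (\<lambda>z :: (real^'n) \<times> (real^'n). snd z $ i)" for i
    by (rule real_polynomial_function.intros(1)
        bounded_linear_compose[OF bounded_linear_vec_nth bounded_linear_fst]
        bounded_linear_compose[OF bounded_linear_vec_nth bounded_linear_snd])+
  have "gram_form B = (\<lambda>z :: (real^'n) \<times> (real^'n). B$1$1 * (fst z \<bullet> fst z) + B$1$2 * (snd z \<bullet> fst z)
      + B$2$1 * (fst z \<bullet> snd z) + B$2$2 * (snd z \<bullet> snd z))"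
    by (auto simp: gram_form_expand)
  moreover have "real_polynomial_function
      (\<lambda>z :: (real^'n) \<times> (real^'n). B$1$1 * (fst z \<bullet> fst z) + B$1$2 * (snd z \<bullet> fst z)
      + B$2$1 * (fst z \<bullet> snd z) + B$2$2 * (snd z \<bullet> snd z))"
    unfolding inner_vec_def inner_real_def
    by (intro real_polynomial_function.intros(3) real_polynomial_function.intros(4)
        real_polynomial_function.intros(2) real_polynomial_function_sum finite coord)
  ultimately have "real_polynomial_function (gram_form B :: (real^'n) \<times> (real^'n) \<Rightarrow> real)"
    by (simp only:)
  moreover have "gram_form B (c *\<^sub>R z) = c ^ 2 * gram_form B z" for c and z :: "(real^'n) \<times> (real^'n)"
    by (cases z) (simp add: gram_form_expand power2_eq_square algebra_simps)
  ultimately show ?thesis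
    unfolding sym_power_iff by blast
qed

lemma subspace_invariant_quartics: "subspace (invariant_quartics G)"
proof -
  have "subspace (sym_power 4 :: ((real^'n) \<times> (real^'n) \<Rightarrow> real) set)"
    by (simp add: sym_power_def)
  then show ?thesis
    unfolding subspace_def invariant_quartics_def by auto
qed

lemma gram_quartics_subset:
  assumes "\<forall>g\<in>G. orthogonal_matrix g"
  shows "gram_quartics \<subseteq> invariant_quartics G"
  unfolding gram_quartics_def
proof (rule span_minimal[OF _ subspace_invariant_quartics], clarify)
  fix B C :: "real^2^2"
  show "(\<lambda>x. gram_form B x * gram_form C x) \<in> invariant_quartics G"
    using sym_power_mult[OF gram_form_sym_power[of B] gram_form_sym_power[of C]] assms
    by (simp add: invariant_quartics_def gram_form_diag_act)
qed

section \<open>The dihedral group in its standard reflection representation\<close>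

definition rotation :: "real \<Rightarrow> real^2^2" where
  "rotation t = vector [vector [cos t, - sin t], vector [sin t, cos t]]"

text \<open>The reflection in the line spanned by \<open>(cos (t/2), sin (t/2))\<close>.\<close>

definition reflection :: "real \<Rightarrow> real^2^2" where
  "reflection t = vector [vector [cos t, sin t], vector [sin t, - cos t]]"

text \<open>The symmetries of the regular \<open>m\<close>-gon with vertices \<open>(cos (2 \<pi> k / m), sin (2 \<pi> k / m))\<close>
  (for \<open>m \<ge> 3\<close>).\<close>

definition dihedral :: "nat \<Rightarrow> (real^2^2) set" where
  "dihedral m = (\<lambda>k. rotation (2 * pi * real k / real m)) ` {..<m}
              \<union> (\<lambda>k. reflection (2 * pi * real k / real m)) ` {..<m}"

lemma rotation_reflection_mult:
  "rotation s ** rotation t = rotation (s + t)"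
  "rotation s ** reflection t = reflection (s + t)"
  "reflection s ** rotation t = reflection (s - t)"
  "reflection s ** reflection t = rotation (s - t)"
  by (simp_all add: rotation_def reflection_def matrix_matrix_mult_def vec_eq_iff forall_2 sum_2
      vector_2 sin_add cos_add sin_diff cos_diff)

lemma rotation_zero: "rotation 0 = mat 1"
  by (simp add: rotation_def mat_def vec_eq_iff forall_2 vector_2)

lemma reflection_square: "reflection t ** reflection t = mat 1"
  by (simp add: rotation_reflection_mult rotation_zero)

lemma reflection_axis:
  "reflection t *v vector [cos (t / 2), sin (t / 2)] = vector [cos (t / 2), sin (t / 2)]"
  "reflection t *v vector [- sin (t / 2), cos (t / 2)] = - vector [- sin (t / 2), cos (t / 2)]"
proof -
  have "cos t = cos (t / 2) * cos (t / 2) - sin (t / 2) * sin (t / 2)"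
    "sin t = 2 * sin (t / 2) * cos (t / 2)"
    using cos_add[of "t/2" "t/2"] sin_add[of "t/2" "t/2"] by auto
  moreover have "sin (t / 2) * sin (t / 2) = 1 - cos (t / 2) * cos (t / 2)"
    using sin_cos_squared_add3[of "t / 2"] by algebra
  ultimately show
  "reflection t *v vector [cos (t / 2), sin (t / 2)] = vector [cos (t / 2), sin (t / 2)]"
  "reflection t *v vector [- sin (t / 2), cos (t / 2)] = - vector [- sin (t / 2), cos (t / 2)]"
    by (simp_all add: reflection_def matrix_vector_mult_def vec_eq_iff forall_2 sum_2 vector_2)
      (algebra+)
qed

lemma orthogonal_rotation: "orthogonal_matrix (rotation t)"
  and orthogonal_reflection: "orthogonal_matrix (reflection t)"
  by (simp_all add: orthogonal_matrix rotation_def reflection_def matrix_matrix_mult_def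
      transpose_def mat_def vec_eq_iff forall_2 sum_2 vector_2 flip: power2_eq_square)

lemma dihedral_orthogonal: "g \<in> dihedral m \<Longrightarrow> orthogonal_matrix g"
  by (auto simp: dihedral_def orthogonal_rotation orthogonal_reflection)

lemma rotation_reflection_mod:
  fixes j :: int
  assumes "m > 0"
  shows "rotation (2 * pi * real_of_int j / real m) = rotation (2 * pi * real (nat (j mod int m)) / real m)"
    and "reflection (2 * pi * real_of_int j / real m) = reflection (2 * pi * real (nat (j mod int m)) / real m)"
proof -
  have "real_of_int j = real m * real_of_int (j div int m) + real (nat (j mod int m))"
  proof -
    have "j = int m * (j div int m) + int (nat (j mod int m))"
      using assms by simp
    then show ?thesis
      by (metis of_int_add of_int_mult of_int_of_nat_eq)
  qed
  then have eq: "2 * pi * real_of_int j / real m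
      = 2 * pi * real (nat (j mod int m)) / real m + 2 * pi * real_of_int (j div int m)"
    using assms by (simp add: field_simps)
  have "cos (2 * pi * real_of_int (j div int m)) = 1" "sin (2 * pi * real_of_int (j div int m)) = 0"
    using cos_int_2pin sin_int_2pin by blast+
  then have "cos (2 * pi * real_of_int j / real m) = cos (2 * pi * real (nat (j mod int m)) / real m)"
    "sin (2 * pi * real_of_int j / real m) = sin (2 * pi * real (nat (j mod int m)) / real m)"
    unfolding eq cos_add sin_add by simp_all
  then show "rotation (2 * pi * real_of_int j / real m) = rotation (2 * pi * real (nat (j mod int m)) / real m)"
    and "reflection (2 * pi * real_of_int j / real m) = reflection (2 * pi * real (nat (j mod int m)) / real m)"
    by (simp_all add: rotation_def reflection_def)
qed

lemma dihedral_eq: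
  assumes "m > 0"
  shows "dihedral m = (\<lambda>j::int. rotation (2 * pi * real_of_int j / real m)) ` UNIV
                    \<union> (\<lambda>j::int. reflection (2 * pi * real_of_int j / real m)) ` UNIV"
proof -
  have n: "nat (j mod int m) < m" for j
    using assms by (simp add: nat_less_iff)
  show ?thesis
    unfolding dihedral_def
  proof (intro arg_cong2[of _ _ _ _ "(\<union>)"] equalityI subsetI; clarify)
    fix k
    show "rotation (2 * pi * real k / real m) \<in> range (\<lambda>j::int. rotation (2 * pi * real_of_int j / real m))"
      "reflection (2 * pi * real k / real m) \<in> range (\<lambda>j::int. reflection (2 * pi * real_of_int j / real m))"
      by (rule range_eqI[of _ _ "int k"]; simp)+
  next
    fix j :: int
    show "rotation (2 * pi * real_of_int j / real m) \<in> (\<lambda>k. rotation (2 * pi * real k / real m)) ` {..<m}"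
      "reflection (2 * pi * real_of_int j / real m) \<in> (\<lambda>k. reflection (2 * pi * real k / real m)) ` {..<m}"
      unfolding rotation_reflection_mod[OF assms, of j] using n by auto
  qed
qed

lemma dihedral_mult:
  assumes "m > 0" "g \<in> dihedral m" "h \<in> dihedral m"
  shows "g ** h \<in> dihedral m"
proof -
  have *: "2 * pi * real_of_int i / real m + 2 * pi * real_of_int j / real m = 2 * pi * real_of_int (i + j) / real m"
    "2 * pi * real_of_int i / real m - 2 * pi * real_of_int j / real m = 2 * pi * real_of_int (i - j) / real m" for i j
    by (simp_all add: add_divide_distrib diff_divide_distrib distrib_left right_diff_distrib)
  show ?thesis
    using assms unfolding dihedral_eq[OF assms(1)]
    by (elim UnE imageE; simp only: rotation_reflection_mult * ) blast+
qed

lemma dihedral_card: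
  assumes "m > 0"
  shows "card (dihedral m) = 2 * m"
proof -
  have angle: "j = k"
    if jk: "j < m" "k < m" "cos (2 * pi * real j / real m) = cos (2 * pi * real k / real m)"
      "sin (2 * pi * real j / real m) = sin (2 * pi * real k / real m)" for j k
  proof -
    obtain n :: int where n: "2 * pi * real j / real m = 2 * pi * real k / real m + 2 * pi * n"
      using jk(3,4) sin_cos_eq_iff by metis
    then have "2 * pi * real j = 2 * pi * (real k + real m * n)"
      using assms by (simp add: field_simps)
    then have "real j = real k + real m * n"
      by simp
    then have "real_of_int (int j) = real_of_int (int k + int m * n)"
      by simp
    then have "int j = int k + int m * n"
      by (simp only: of_int_eq_iff)
    then have "int j mod int m = int k mod int m"
      by simp
    then have "int (j mod m) = int (k mod m)"
      by (simp only: zmod_int)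
    then show ?thesis using jk(1,2) by simp
  qed
  have inj: "inj_on (\<lambda>k. rotation (2 * pi * real k / real m)) {..<m}"
    "inj_on (\<lambda>k. reflection (2 * pi * real k / real m)) {..<m}"
    by (auto intro!: inj_onI angle simp: rotation_def reflection_def vec_eq_iff forall_2 vector_2)
  have "det (rotation s) = 1" "det (reflection s) = -1" for s
    using sin_cos_squared_add3[of s]
    by (simp_all add: rotation_def reflection_def det_2 vector_2 algebra_simps)
  then have "rotation s \<noteq> reflection t" for s t
    by (metis one_neq_neg_one)
  then show ?thesis
    unfolding dihedral_def
    by (subst card_Un_disjoint) (auto simp: card_image[OF inj(1)] card_image[OF inj(2)])
qed

end

theory Submission
  imports Defs
begin

text \<open>For \<open>m = 3\<close> and \<open>m \<ge> 5\<close> the averages of \<open>cos\<close> and \<open>sin\<close> of \<open>2t\<close> and \<open>4t\<close> over the rotation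
  angles of the group vanish, so the average of a product of four linear forms over the cyclic
  group is the same as its average over the whole circle.  With \<open>J\<close> the rotation by a right angle
  and \<open>N\<^sub>i\<^sub>j(x) = l\<^sub>i(x) l\<^sub>j(x) + l\<^sub>i(Jx) l\<^sub>j(Jx)\<close>, that average is
  \<open>(N\<^sub>0\<^sub>1 N\<^sub>2\<^sub>3 + N\<^sub>0\<^sub>2 N\<^sub>1\<^sub>3 + N\<^sub>0\<^sub>3 N\<^sub>1\<^sub>2) / 8\<close>.  Each \<open>N\<^sub>i\<^sub>j\<close> is a Gram form plus a multiple of
  \<open>d(x) = det (x\<^sub>1, x\<^sub>2)\<close>.  Averaging with a reflection removes the terms that are odd in \<open>d\<close>, and
  \<open>d\<^sup>2\<close> is the determinant of the Gram matrix.  An invariant quartic equals its own average, so it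
  is a Gram quartic.  For \<open>m = 4\<close> the invariant \<open>x\<^sup>4 + y\<^sup>4\<close> of the first summand is not a function
  of the Gram matrix.\<close>

section \<open>Linear forms on pairs of plane vectors and their rotation pairings\<close>

definition planar_det :: "(real^2) \<times> (real^2) \<Rightarrow> real" where
  "planar_det x = fst x $ 1 * snd x $ 2 - fst x $ 2 * snd x $ 1"

text \<open>Twice the average of \<open>l * k\<close> over the rotation orbit of \<open>x\<close>;
  rotation by \<open>pi/2\<close> plays the role of multiplication by the imaginary unit.\<close>

definition rot_pairing ::
    "((real^2) \<times> (real^2) \<Rightarrow> real) \<Rightarrow> ((real^2) \<times> (real^2) \<Rightarrow> real) \<Rightarrow> (real^2) \<times> (real^2) \<Rightarrow> real" where
  "rot_pairing l k x = l x * k x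
     + l (diag_act (rotation (pi/2)) x) * k (diag_act (rotation (pi/2)) x)"

lemma linear_form_expand:
  fixes l :: "(real^2) \<times> (real^2) \<Rightarrow> real"
  assumes "linear l"
  shows "l x = l (axis 1 1, 0) * fst x $ 1 + l (axis 2 1, 0) * fst x $ 2
             + l (0, axis 1 1) * snd x $ 1 + l (0, axis 2 1) * snd x $ 2"
proof -
  have "x = fst x $ 1 *\<^sub>R (axis 1 1, 0) + fst x $ 2 *\<^sub>R (axis 2 1, 0)
          + snd x $ 1 *\<^sub>R (0, axis 1 1) + snd x $ 2 *\<^sub>R (0, axis 2 1)"
    by (simp add: prod_eq_iff vec_eq_iff forall_2 axis_def)
  then have "l x = l (fst x $ 1 *\<^sub>R (axis 1 1, 0) + fst x $ 2 *\<^sub>R (axis 2 1, 0)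
          + snd x $ 1 *\<^sub>R (0, axis 1 1) + snd x $ 2 *\<^sub>R (0, axis 2 1))"
    by (rule arg_cong)
  also have "\<dots> = l (axis 1 1, 0) * fst x $ 1 + l (axis 2 1, 0) * fst x $ 2
             + l (0, axis 1 1) * snd x $ 1 + l (0, axis 2 1) * snd x $ 2"
    by (simp only: linear_add[OF assms] linear_scale[OF assms] real_scaleR_def mult.commute)
  finally show ?thesis .
qed

text \<open>A rotation is \<open>cos t\<close> times the identity plus \<open>sin t\<close> times
  the quarter turn, so a linear form along a rotation orbit is a combination of \<open>cos t\<close>
  and \<open>sin t\<close>.\<close>

lemma diag_act_rotation:
  "diag_act (rotation t) x = cos t *\<^sub>R x + sin t *\<^sub>R diag_act (rotation (pi/2)) x"
  by (cases x)
    (simp add: diag_act_def rotation_def matrix_vector_mult_def vec_eq_iff forall_2 sum_2 vector_2)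

lemma linear_diag_act_rotation:
  assumes "linear l"
  shows "l (diag_act (rotation t) x) = l x * cos t + l (diag_act (rotation (pi/2)) x) * sin t"
  by (subst diag_act_rotation) (simp add: linear_add[OF assms] linear_scale[OF assms])

text \<open>Write \<open>l (u, v)\<close> as a.u + b.v, and \<open>k\<close> likewise with a', b'.
  With J the quarter turn, (a.u)(b'.v) + (a.Ju)(b'.Jv) = (a.b')(u.v) + det(a,b') det(u,v). The terms
  in u alone and in v alone contribute no determinant.\<close>

lemma rot_pairing_eq:
  assumes "linear l" "linear k"
  obtains B c where "transpose B = B"
    "\<And>x. rot_pairing l k x = gram_form B x + c * planar_det x"
proof -
  define a1 a2 b1 b2 where "a1 = l (axis 1 1, 0)" "a2 = l (axis 2 1, 0)"
    "b1 = l (0, axis 1 1)" "b2 = l (0, axis 2 1)"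
  define a1' a2' b1' b2' where "a1' = k (axis 1 1, 0)" "a2' = k (axis 2 1, 0)"
    "b1' = k (0, axis 1 1)" "b2' = k (0, axis 2 1)"
  note defs = a1_a2_b1_b2_def[symmetric] a1'_a2'_b1'_b2'_def[symmetric]
  \<comment> \<open>The coefficient of u.v is split equally between the two off-diagonal entries,
    which makes \<open>B\<close> symmetric.\<close>
  define h where "h = (a1 * b1' + a2 * b2' + b1 * a1' + b2 * a2') / 2"
  define B :: "real^2^2" where
    "B = vector [vector [a1 * a1' + a2 * a2', h], vector [h, b1 * b1' + b2 * b2']]"
  define c where "c = a1 * b2' - a2 * b1' + b2 * a1' - b1 * a2'"
  have "transpose B = B"
    by (simp add: B_def transpose_def vec_eq_iff forall_2 vector_2)
  moreover have "rot_pairing l k x = gram_form B x + c * planar_det x" for x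
  proof -
    obtain u v where x: "x = (u, v)" by (cases x)
    have J: "diag_act (rotation (pi/2)) x = (vector [- (u$2), u$1], vector [- (v$2), v$1])"
      by (simp add: x diag_act_def rotation_def matrix_vector_mult_def vec_eq_iff forall_2
          sum_2 vector_2)
    show ?thesis
      unfolding rot_pairing_def J
      unfolding linear_form_expand[OF assms(1), of x] linear_form_expand[OF assms(2), of x]
        linear_form_expand[OF assms(1), of "(vector _, _)"]
        linear_form_expand[OF assms(2), of "(vector _, _)"] defs
      unfolding x B_def gram_form_expand planar_det_def c_def h_def
      by (simp add: vector_2 inner_vec_def sum_2 add_divide_distrib algebra_simps)
  qed
  ultimately show ?thesis using that by blast
qed

section \<open>Gram quartics and the squared determinant\<close>

lemma gram_quartics_mult:
  "transpose B = B \<Longrightarrow> transpose C = C \<Longrightarrow> (\<lambda>x. gram_form B x * gram_form C x) \<in> gram_quartics"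
  unfolding gram_quartics_def by (intro span_base) blast

lemma subspace_gram_quartics: "subspace gram_quartics"
  by (simp add: gram_quartics_def)

lemma gram_quartics_add:
  "f \<in> gram_quartics \<Longrightarrow> g \<in> gram_quartics \<Longrightarrow> (\<lambda>x. f x + g x) \<in> gram_quartics"
  using subspace_add[OF subspace_gram_quartics, of f g] by (simp add: plus_fun_def)

lemma gram_quartics_scale:
  "f \<in> gram_quartics \<Longrightarrow> (\<lambda>x. c * f x) \<in> gram_quartics"
  using subspace_scale[OF subspace_gram_quartics, of f c] by (simp add: scaleR_fun_def)

lemma planar_det_square: "(\<lambda>x. planar_det x * planar_det x) \<in> gram_quartics"
proof -
  \<comment> \<open>The Gram forms of \<open>E1\<close>, \<open>E2\<close> and \<open>F\<close> are
    the entries u.u, v.v and u.v of the Gram matrix.\<close>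
  define E1 E2 F :: "real^2^2" where "E1 = vector [vector [1, 0], vector [0, 0]]"
    "E2 = vector [vector [0, 0], vector [0, 1]]" "F = vector [vector [0, 1/2], vector [1/2, 0]]"
  note defs = E1_E2_F_def
  have sym: "transpose E1 = E1" "transpose E2 = E2" "transpose F = F"
    by (simp_all add: defs transpose_def vec_eq_iff forall_2 vector_2)
  have "planar_det x * planar_det x
      = gram_form E1 x * gram_form E2 x + (-1) * (gram_form F x * gram_form F x)" for x
    by (cases x) (simp add: planar_det_def gram_form_expand defs vector_2 inner_vec_def sum_2
        algebra_simps)
  then show ?thesis
    by (simp only:) (intro gram_quartics_add gram_quartics_scale gram_quartics_mult sym)
qed

text \<open>A linear map multiplies the determinant of a pair by its own determinant, here
  -1.\<close>

lemma planar_det_reflection: "planar_det (diag_act (reflection t) x) = - planar_det x"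
proof (cases x)
  case (Pair u v)
  define c s where "c = cos t" "s = sin t"
  have "planar_det (diag_act (reflection t) x) = (- (c * c + s * s)) * planar_det x"
    unfolding reflection_def c_s_def[symmetric]
    by (simp add: Pair planar_det_def diag_act_def matrix_vector_mult_def sum_2
        vector_2 algebra_simps)
  then show ?thesis
    using sin_cos_squared_add3[of t] by (simp add: c_s_def)
qed

lemma rot_pairing_mult_symmetrised:
  assumes "linear l" "linear k" "linear l'" "linear k'"
  shows "(\<lambda>x. rot_pairing l k x * rot_pairing l' k' x
      + rot_pairing l k (diag_act (reflection t) x) * rot_pairing l' k' (diag_act (reflection t) x))
    \<in> gram_quartics"
proof -
  obtain B c where B: "transpose B = B"
    "\<And>x. rot_pairing l k x = gram_form B x + c * planar_det x"
    using rot_pairing_eq[OF assms(1,2)] by blast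
  obtain B' c' where B': "transpose B' = B'"
    "\<And>x. rot_pairing l' k' x = gram_form B' x + c' * planar_det x"
    using rot_pairing_eq[OF assms(3,4)] by blast
  \<comment> \<open>The reflection fixes the Gram forms and negates \<open>planar_det\<close>: mixed
    terms cancel, the others double.\<close>
  have "rot_pairing l k x * rot_pairing l' k' x
      + rot_pairing l k (diag_act (reflection t) x) * rot_pairing l' k' (diag_act (reflection t) x)
      = 2 * (gram_form B x * gram_form B' x) + (2 * c * c') * (planar_det x * planar_det x)" for x
    unfolding B(2) B'(2) planar_det_reflection gram_form_diag_act[OF orthogonal_reflection]
    by (simp add: algebra_simps)
  then show ?thesis
    using B(1) B'(1)
    by (simp only:) (intro gram_quartics_add gram_quartics_scale gram_quartics_mult
        planar_det_square)
qed

section \<open>Averaging over the rotations and the dihedral group\<close>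

lemma sum_cos_sin_roots_of_unity:
  assumes "m > 0" "\<not> m dvd j"
  shows "(\<Sum>k<m. cos (real j * (2 * pi * real k / real m))) = 0"
    and "(\<Sum>k<m. sin (real j * (2 * pi * real k / real m))) = 0"
proof -
  \<comment> \<open>The summands are the real and imaginary parts of the powers of this m-th root of
    unity. Their geometric sum vanishes because \<open>w = 1\<close> would force
    \<open>m dvd j\<close>.\<close>
  define w where "w = cis (2 * pi * real j / real m)"
  have pow: "w ^ k = cis (real j * (2 * pi * real k / real m))" for k
    unfolding w_def Complex.DeMoivre by (rule arg_cong[of _ _ cis]) simp
  have "w \<noteq> 1"
  proof
    assume "w = 1"
    then have "cos (2 * pi * real j / real m) = 1"
      by (simp add: w_def complex_eq_iff)
    then obtain n :: int where "2 * pi * real j / real m = of_int n * 2 * pi"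
      using cos_one_2pi_int by blast
    then have "real j = of_int n * real m"
      using assms(1) by (simp add: field_simps)
    then have "int j = n * int m"
      by (metis of_int_eq_iff of_int_mult of_int_of_nat_eq)
    then have "int m dvd int j" by simp
    then show False using assms(2) by simp
  qed
  moreover have "w ^ m = 1"
    using assms(1) cis_multiple_2pi[of "real j"] by (simp add: pow mult.commute)
  ultimately have "(\<Sum>k<m. w ^ k) = 0"
    by (simp add: geometric_sum)
  then have *: "(\<Sum>k<m. cis (real j * (2 * pi * real k / real m))) = 0"
    by (simp only: pow)
  show "(\<Sum>k<m. cos (real j * (2 * pi * real k / real m))) = 0"
    using arg_cong[OF *, of Re] by simp
  show "(\<Sum>k<m. sin (real j * (2 * pi * real k / real m))) = 0"
    using arg_cong[OF *, of Im] by simp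
qed

text \<open>With z_i = A i + sqrt(-1) B i, \<open>N i j\<close> is the real part of z_i times the
  conjugate of z_j, while \<open>P i j\<close> and \<open>Q i j\<close> are the real and imaginary
  parts of z_i z_j. The result is the Fourier expansion of the product, with only the frequencies 0,
  2 and 4.\<close>

lemma trig_product:
  fixes A B :: "nat \<Rightarrow> real"
  defines "N \<equiv> \<lambda>i j. A i * A j + B i * B j"
  defines "P \<equiv> \<lambda>i j. A i * A j - B i * B j"
  defines "Q \<equiv> \<lambda>i j. A i * B j + B i * A j"
  shows "8 * (\<Prod>i<4. A i * cos t + B i * sin t)
    = N 0 1 * N 2 3 + N 0 2 * N 1 3 + N 0 3 * N 1 2
    + 2 * (N 0 1 * P 2 3 + P 0 1 * N 2 3) * cos (2 * t)
    + 2 * (N 0 1 * Q 2 3 + Q 0 1 * N 2 3) * sin (2 * t)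
    + (P 0 1 * P 2 3 - Q 0 1 * Q 2 3) * cos (4 * t)
    + (P 0 1 * Q 2 3 + Q 0 1 * P 2 3) * sin (4 * t)"
proof -
  define C S where "C = cos (2 * t)" "S = sin (2 * t)"
  have c: "cos t * cos t = (1 + C) / 2" "sin t * sin t = (1 - C) / 2" "cos t * sin t = S / 2"
    using cos_double_cos[of t] cos_double_sin[of t] sin_double[of t]
    by (simp_all add: C_S_def power2_eq_square)
  have pair: "2 * ((A i * cos t + B i * sin t) * (A j * cos t + B j * sin t))
      = N i j + P i j * C + Q i j * S" for i j
  proof -
    have "(A i * cos t + B i * sin t) * (A j * cos t + B j * sin t)
      = A i * A j * (cos t * cos t) + B i * B j * (sin t * sin t) + Q i j * (cos t * sin t)"
      by (simp add: Q_def algebra_simps)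
    then show ?thesis
      unfolding c by (simp add: N_def P_def field_simps)
  qed
  have CS: "2 * (C * C) = 1 + cos (4 * t)" "2 * (S * S) = 1 - cos (4 * t)"
      "2 * (C * S) = sin (4 * t)"
    using cos_double_cos[of "2 * t"] cos_double_sin[of "2 * t"] sin_double[of "2 * t"]
    by (simp_all add: C_S_def power2_eq_square)
  have "(\<Prod>i<4. A i * cos t + B i * sin t)
      = ((A 0 * cos t + B 0 * sin t) * (A 1 * cos t + B 1 * sin t))
      * ((A 2 * cos t + B 2 * sin t) * (A 3 * cos t + B 3 * sin t))"
    by (simp add: eval_nat_numeral)
  then have "8 * (\<Prod>i<4. A i * cos t + B i * sin t)
      = 2 * ((N 0 1 + P 0 1 * C + Q 0 1 * S) * (N 2 3 + P 2 3 * C + Q 2 3 * S))"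
    unfolding pair[symmetric] by simp
  also have "\<dots> = 2 * (N 0 1 * N 2 3)
      + 2 * (N 0 1 * P 2 3 + P 0 1 * N 2 3) * C + 2 * (N 0 1 * Q 2 3 + Q 0 1 * N 2 3) * S
      + P 0 1 * P 2 3 * (2 * (C * C)) + Q 0 1 * Q 2 3 * (2 * (S * S))
      + (P 0 1 * Q 2 3 + Q 0 1 * P 2 3) * (2 * (C * S))"
    by (simp add: algebra_simps)
  also have "\<dots> = 2 * (N 0 1 * N 2 3) + (P 0 1 * P 2 3 + Q 0 1 * Q 2 3)
      + 2 * (N 0 1 * P 2 3 + P 0 1 * N 2 3) * C + 2 * (N 0 1 * Q 2 3 + Q 0 1 * N 2 3) * S
      + (P 0 1 * P 2 3 - Q 0 1 * Q 2 3) * cos (4 * t)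
      + (P 0 1 * Q 2 3 + Q 0 1 * P 2 3) * sin (4 * t)"
    unfolding CS by (simp add: algebra_simps)
  \<comment> \<open>Grouping the factors as 01 and 23 hid the symmetry of the constant term; this
    identity restores the sum over all three pairings.\<close>
  also have "2 * (N 0 1 * N 2 3) + (P 0 1 * P 2 3 + Q 0 1 * Q 2 3)
      = N 0 1 * N 2 3 + N 0 2 * N 1 3 + N 0 3 * N 1 2"
    by (simp add: N_def P_def Q_def algebra_simps)
  finally show ?thesis by (simp add: C_S_def)
qed

lemma rotation_average:
  fixes l :: "nat \<Rightarrow> (real^2) \<times> (real^2) \<Rightarrow> real"
  assumes m: "m > 0" "\<not> m dvd 2" "\<not> m dvd 4" and l: "\<forall>i<4. linear (l i)"
  shows "8 * (\<Sum>k<m. \<Prod>i<4. l i (diag_act (rotation (2 * pi * real k / real m)) x))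
    = real m * (rot_pairing (l 0) (l 1) x * rot_pairing (l 2) (l 3) x
      + rot_pairing (l 0) (l 2) x * rot_pairing (l 1) (l 3) x
      + rot_pairing (l 0) (l 3) x * rot_pairing (l 1) (l 2) x)"
proof -
  have rot: "(\<Prod>i<4. l i (diag_act (rotation t) x))
      = (\<Prod>i<4. l i x * cos t + l i (diag_act (rotation (pi/2)) x) * sin t)" for t
    using l by (intro prod.cong refl linear_diag_act_rotation) simp
  have sums: "(\<Sum>k<m. cos (2 * (2 * pi * real k / real m))) = 0"
    "(\<Sum>k<m. sin (2 * (2 * pi * real k / real m))) = 0"
    "(\<Sum>k<m. cos (4 * (2 * pi * real k / real m))) = 0"
    "(\<Sum>k<m. sin (4 * (2 * pi * real k / real m))) = 0"
    using sum_cos_sin_roots_of_unity[OF m(1,2)] sum_cos_sin_roots_of_unity[OF m(1,3)]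
    by simp_all
  show ?thesis
    unfolding rot sum_distrib_left trig_product
    unfolding sum.distrib sum_distrib_left[symmetric] sums rot_pairing_def
    by (simp only: mult_zero_right add_0_right sum_constant card_lessThan) (simp add: algebra_simps)
qed

text \<open>Since \<open>rotation t ** reflection 0 = reflection t\<close>, the sum runs over the
  whole group. It is linear in \<open>f\<close>, so products of four linear forms suffice.\<close>

lemma dihedral_average:
  assumes m: "m > 0" "\<not> m dvd 2" "\<not> m dvd 4" and f: "f \<in> sym_power 4"
  shows "(\<lambda>x. \<Sum>k<m. f (diag_act (rotation (2 * pi * real k / real m)) x)
      + f (diag_act (rotation (2 * pi * real k / real m)) (diag_act (reflection 0) x)))
    \<in> gram_quartics" (is "?R f \<in> _")
  using f unfolding sym_power_def
proof (induction rule: span_induct_alt)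
  case base
  then show ?case
    using subspace_0[OF subspace_gram_quartics] by (simp add: zero_fun_def)
next
  case (step c u f)
  then obtain l :: "nat \<Rightarrow> (real^2) \<times> (real^2) \<Rightarrow> real" where u: "u = (\<lambda>x. \<Prod>i<4. l i x)" and l: "\<forall>i<4. linear (l i)"
    by auto
  define M where "M i j i' j' x = rot_pairing (l i) (l j) x * rot_pairing (l i') (l j') x
      + rot_pairing (l i) (l j) (diag_act (reflection 0) x)
        * rot_pairing (l i') (l j') (diag_act (reflection 0) x)" for i j i' j' x
  have M: "M i j i' j' \<in> gram_quartics" if "i < 4" "j < 4" "i' < 4" "j' < 4" for i j i' j'
    unfolding M_def using that l by (intro rot_pairing_mult_symmetrised) auto
  have "?R u = (\<lambda>x. real m / 8 * (M 0 1 2 3 x + M 0 2 1 3 x + M 0 3 1 2 x))"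
  proof
    fix x
    have "8 * ?R u x = real m * (M 0 1 2 3 x + M 0 2 1 3 x + M 0 3 1 2 x)"
      unfolding u sum.distrib distrib_left[of 8] rotation_average[OF m l] M_def
      by (simp add: algebra_simps)
    then show "?R u x = real m / 8 * (M 0 1 2 3 x + M 0 2 1 3 x + M 0 3 1 2 x)"
      by simp
  qed
  also have "\<dots> \<in> gram_quartics"
    by (intro gram_quartics_scale gram_quartics_add M) simp_all
  finally have "(\<lambda>x. c * ?R u x + ?R f x) \<in> gram_quartics"
    using step.IH by (intro gram_quartics_add gram_quartics_scale)
  moreover have "(\<lambda>x. c * ?R u x + ?R f x) = ?R (c *\<^sub>R u + f)"
    by (simp add: sum_distrib_left sum.distrib algebra_simps)
  ultimately show ?case by simp
qed

lemma invariant_quartics_dihedral: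
  assumes m: "m > 0" "\<not> m dvd 2" "\<not> m dvd 4"
  shows "invariant_quartics (dihedral m) = gram_quartics"
proof
  show "gram_quartics \<subseteq> invariant_quartics (dihedral m)"
    by (intro gram_quartics_subset ballI dihedral_orthogonal)
  show "invariant_quartics (dihedral m) \<subseteq> gram_quartics"
  proof
    fix f assume f: "f \<in> invariant_quartics (dihedral m)"
    have rot: "f (diag_act (rotation (2 * pi * real k / real m)) x) = f x" if "k < m" for k x
    proof -
      have "rotation (2 * pi * real k / real m) \<in> dihedral m"
        using that by (auto simp: dihedral_def)
      then show ?thesis
        using f unfolding invariant_quartics_def by blast
    qed
    have "reflection 0 \<in> dihedral m"
      using m(1) by (auto simp: dihedral_def intro!: image_eqI[of _ _ 0])
    then have refl: "f (diag_act (reflection 0) x) = f x" for x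
      using f unfolding invariant_quartics_def by blast
    have "(\<lambda>x. \<Sum>k<m. f (diag_act (rotation (2 * pi * real k / real m)) x)
      + f (diag_act (rotation (2 * pi * real k / real m)) (diag_act (reflection 0) x)))
      \<in> gram_quartics"
      using f by (intro dihedral_average m) (simp add: invariant_quartics_def)
    \<comment> \<open>By invariance each of the 2m summands equals \<open>f x\<close>.\<close>
    then have "(\<lambda>x. real m * (2 * f x)) \<in> gram_quartics"
      by (simp add: rot refl)
    from gram_quartics_scale[OF this, of "1 / (2 * real m)"] show "f \<in> gram_quartics"
      using m(1) by simp
  qed
qed

section \<open>Vanishing of the quotient as an inclusion\<close>

lemma coset_gram_quartics_eq_iff:
  fixes f :: "(real^'n) \<times> (real^'n) \<Rightarrow> real"
  shows "f +o gram_quartics = 0 +o gram_quartics \<longleftrightarrow> f \<in> gram_quartics"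
proof
  assume "f +o gram_quartics = 0 +o gram_quartics"
  moreover have "f + 0 \<in> f +o gram_quartics"
    using subspace_0[OF subspace_gram_quartics] by (rule set_plus_intro2)
  ultimately show "f \<in> gram_quartics" by simp
next
  assume f: "f \<in> gram_quartics"
  show "f +o gram_quartics = 0 +o gram_quartics"
  proof (intro equalityI subsetI)
    fix g :: "(real^'n) \<times> (real^'n) \<Rightarrow> real" assume "g \<in> f +o gram_quartics"
    then show "g \<in> 0 +o gram_quartics"
      using f subspace_add[OF subspace_gram_quartics] by (auto simp: elt_set_plus_def)
  next
    fix g :: "(real^'n) \<times> (real^'n) \<Rightarrow> real" assume "g \<in> 0 +o gram_quartics"
    then have "g - f \<in> gram_quartics"
      using f subspace_diff[OF subspace_gram_quartics] by auto
    then have "f + (g - f) \<in> f +o gram_quartics" by (rule set_plus_intro2)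
    then show "g \<in> f +o gram_quartics" by simp
  qed
qed

lemma primitive_quartics_trivial_iff:
  "primitive_quartics G = {0 +o gram_quartics} \<longleftrightarrow> invariant_quartics G \<subseteq> gram_quartics"
proof -
  \<comment> \<open>This makes the set of cosets nonempty, so it is the singleton exactly when every
    coset is the zero coset.\<close>
  have "0 \<in> invariant_quartics G"
    using subspace_invariant_quartics by (rule subspace_0)
  then have "primitive_quartics G = {0 +o gram_quartics}
      \<longleftrightarrow> (\<forall>f\<in>invariant_quartics G. f +o gram_quartics = 0 +o gram_quartics)"
    unfolding primitive_quartics_def by blast
  then show ?thesis
    unfolding coset_gram_quartics_eq_iff by blast
qed

section \<open>A primitive quartic for the square\<close>

lemma sum_fourth_powers_invariant:
  "(\<lambda>x. fst x $ 1 ^ 4 + fst x $ 2 ^ 4) \<in> invariant_quartics (dihedral 4)"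
proof -
  let ?f = "\<lambda>x :: (real^2) \<times> (real^2). fst x $ 1 ^ 4 + fst x $ 2 ^ 4"
  have coord: "real_polynomial_function (\<lambda>x :: (real^2) \<times> (real^2). fst x $ i)" for i
    by (intro real_polynomial_function.intros(1)
        bounded_linear_compose[OF bounded_linear_vec_nth bounded_linear_fst])
  have "real_polynomial_function ?f"
    by (intro real_polynomial_function.intros(3) real_polynomial_function_power coord)
  then have "?f \<in> sym_power 4"
    unfolding sym_power_iff by (simp add: power_mult_distrib distrib_left)
  moreover have "?f (diag_act g x) = ?f x" if g: "g \<in> dihedral 4" for g x
  proof -
    obtain k :: nat where k: "g = rotation (2 * pi * k / 4) \<or> g = reflection (2 * pi * k / 4)"
      using g by (auto simp: dihedral_def)
    define c s where "c = cos (2 * pi * k / 4)" "s = sin (2 * pi * k / 4)"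
    \<comment> \<open>The doubled angle is \<open>k * pi\<close>. Hence \<open>c = 0\<close> or
      \<open>s = 0\<close>, and each group element permutes the two coordinates up to signs.\<close>
    have "sin (2 * (2 * pi * k / 4)) = 0"
      using sin_npi[of k] by (simp add: mult.commute)
    then have "c = 0 \<or> s = 0"
      unfolding sin_double c_s_def by auto
    moreover have "s\<^sup>2 + c\<^sup>2 = 1"
      by (simp add: c_s_def)
    moreover have "s ^ 4 = (s\<^sup>2)\<^sup>2" "c ^ 4 = (c\<^sup>2)\<^sup>2"
      by simp_all
    ultimately have "c = 0 \<and> s ^ 4 = 1 \<or> s = 0 \<and> c ^ 4 = 1"
      by (elim disjE) simp_all
    then show ?thesis
      using k unfolding rotation_def reflection_def c_s_def[symmetric]
      by (cases x) (auto simp: diag_act_def matrix_vector_mult_def sum_2 vector_2 power_mult_distrib)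
  qed
  ultimately show ?thesis
    by (simp add: invariant_quartics_def)
qed

text \<open>Gram quartics factor through the Gram matrix, so two points with equal Gram matrices can
  refute membership.\<close>

lemma gram_quartics_cong:
  assumes "f \<in> gram_quartics" "gram x = gram y"
  shows "f x = f y"
  using assms(1) unfolding gram_quartics_def
proof (induction rule: span_induct_alt)
  case (step c u g)
  then show ?case
    using assms(2) by (auto simp: gram_form_def)
qed simp

lemma sum_fourth_powers_not_gram:
  "(\<lambda>x :: (real^2) \<times> (real^2). fst x $ 1 ^ 4 + fst x $ 2 ^ 4) \<notin> gram_quartics"
proof
  \<comment> \<open>Both first vectors have length 5 and both second vectors vanish, but the sums of
    fourth powers are 625 and 81 + 256 = 337.\<close>
  define x y :: "(real^2) \<times> (real^2)" where "x = (vector [5, 0], 0)" "y = (vector [3, 4], 0)"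
  assume "(\<lambda>x :: (real^2) \<times> (real^2). fst x $ 1 ^ 4 + fst x $ 2 ^ 4) \<in> gram_quartics"
  moreover have "gram x = gram y"
    by (simp add: x_y_def gram_def inner_vec_def sum_2 vector_2)
  ultimately have "fst x $ 1 ^ 4 + fst x $ 2 ^ 4 = fst y $ 1 ^ 4 + fst y $ 2 ^ 4"
    by (rule gram_quartics_cong)
  then show False
    by (simp add: x_y_def vector_2)
qed

theorem proposition3p5:
  shows "(\<forall>m. m = 3 \<or> m \<ge> 5 \<longrightarrow> primitive_quartics (dihedral m) = {0 +o gram_quartics})
       \<and> primitive_quartics (dihedral 4) \<noteq> {0 +o gram_quartics}"
proof (intro conjI allI impI)
  fix m :: nat assume m: "m = 3 \<or> m \<ge> 5"
  \<comment> \<open>Only 1, 2 and 4 divide 2 or 4.\<close>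
  then have "\<not> m dvd 2" "\<not> m dvd 4"
    by (auto dest: dvd_imp_le)
  moreover have "m > 0" using m by auto
  ultimately show "primitive_quartics (dihedral m) = {0 +o gram_quartics}"
    unfolding primitive_quartics_trivial_iff using invariant_quartics_dihedral by blast
next
  show "primitive_quartics (dihedral 4) \<noteq> {0 +o gram_quartics}"
    unfolding primitive_quartics_trivial_iff
    using sum_fourth_powers_invariant sum_fourth_powers_not_gram by blast
qed

end
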